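(* Let $n$ be a positive integer and let $S(\pi,\eta)\subseteq\mathbb{R}^n$ be an arbitrary $2$-sparse split set, that is, $\pi\in\mathbb{Z}^n$, $\|\pi\|_0\le 2$, $\eta\in\mathbb{Z}$. Then there exists a split set in $\mathcal{F}_2$ that dominates $S(\pi,\eta)$.
   Context: For $\pi\in\mathbb{Z}^n$ and $\eta\in\mathbb{Z}$, the split set is the open set $S(\pi,\eta):=\{x\in\mathbb{R}^n \mid \eta<\pi^{\top}x<\eta+1\}$. Let $\|\pi\|_0$ denote the number of non-zero entries of $\pi$; the split set $S(\pi,\eta)$ is called $k$-sparse if $\|\pi\|_0\le k$. A split set $S(\pi^1,\eta^1)\subseteq\mathbb{R}^n$ dominates a split set $S(\pi^0,\eta^0)\subseteq\mathbb{R}^n$ if $S(\pi^1,\eta^1)\cap[0,1]^n\supseteq S(\pi^0,\eta^0)\cap[0,1]^n$. $\mathcal{F}_k$ denotes the finite list of all $k$-sparse split sets $S(\pi,\eta)\subseteq\mathbb{R}^n$ with $\pi\in\{-1,0,1\}^n$, $\|\pi\|_0\le k$, and $\eta\in\{-k,\dots,-1,0,1,\dots,k\}$; $\mathcal{F}_2$ is the case $k=2$. *)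

theory Defs
  imports "HOL-Analysis.Analysis"
begin

definition split_set :: "int ^ 'n \<Rightarrow> int \<Rightarrow> (real ^ 'n) set" where
  "split_set \<pi> \<eta> =
     {x. of_int \<eta> < (\<chi> i. of_int (\<pi> $ i)) \<bullet> x \<and> (\<chi> i. of_int (\<pi> $ i)) \<bullet> x < of_int \<eta> + 1}"

definition norm0 :: "int ^ 'n \<Rightarrow> nat" where
  "norm0 \<pi> = card {i. \<pi> $ i \<noteq> 0}"

(* Sparsity is a property of the defining data, not of the point set; the integer offset
   plays no role in it. *)
definition sparse_split :: "nat \<Rightarrow> int ^ 'n \<Rightarrow> int \<Rightarrow> bool" where
  "sparse_split k \<pi> \<eta> \<longleftrightarrow> norm0 \<pi> \<le> k"

definition dominates :: "(real ^ 'n) set \<Rightarrow> (real ^ 'n) set \<Rightarrow> bool" where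
  "dominates S1 S0 \<longleftrightarrow> S1 \<inter> cbox 0 1 \<supseteq> S0 \<inter> cbox 0 1"

definition split_family :: "nat \<Rightarrow> (real ^ 'n) set set" where
  "split_family k =
     {split_set \<pi> \<eta> | \<pi> \<eta>.
        sparse_split k \<pi> \<eta> \<and> (\<forall>i. \<pi> $ i \<in> {-1, 0, 1}) \<and> \<eta> \<in> {- int k..int k}}"

end

theory Submission
  imports Defs
begin

text \<open>
  A split set with at most two non-zero coefficients depends on two coordinates only, so the
  question is about strips \<open>\<eta> < a x + b y < \<eta> + 1\<close> in the unit square. Reflecting a coordinate
  (\<open>x \<mapsto> 1 - x\<close>) negates its coefficient and shifts the offset by an integer; both the given
  strips and the strips with coefficients in \<open>{-1, 0, 1}\<close> are stable under this, and under
  exchanging the coordinates. This reduces the question to \<open>a \<ge> b \<ge> 0\<close>.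

  There the vertices of the square take the values \<open>0 \<le> b \<le> a \<le> a + b\<close>, and, \<open>\<eta>\<close> being an
  integer, the open strip lies between two consecutive ones of them (or misses the square).
  By convexity, the segments joining vertices on the same side of the strip do not meet it, and
  these segments confine the part of the strip in the square: below \<open>b\<close> it is cut off by the
  diagonal \<open>x + y = 1\<close> and lies in \<open>0 < x + y < 1\<close>; between \<open>b\<close> and \<open>a\<close> it lies in \<open>0 < x < 1\<close>; above \<open>a\<close> it lies
  in \<open>1 < x + y < 2\<close>. This is \<open>square_dominated_ordered\<close>.

  The offset of the dominating strip need not be tracked through the reflections: a linear form
  with \<open>k\<close> coefficients from \<open>{-1, 0, 1}\<close> has absolute value at most \<open>k\<close> on the cube, which bounds
  the offset of any such strip meeting the cube.
\<close>

text \<open>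
  Zero coefficients must stay zero so that a form in fewer than two variables, which
  is the only possibility in dimension one, is dominated by a form in the same variables.
\<close>
definition square_dominated :: "int \<Rightarrow> int \<Rightarrow> int \<Rightarrow> bool" where
  "square_dominated a b \<eta> \<longleftrightarrow>
     (\<exists>p\<in>{-1, 0, 1}. \<exists>q\<in>{-1, 0, 1}. \<exists>e::int. (a = 0 \<longrightarrow> p = 0) \<and> (b = 0 \<longrightarrow> q = 0) \<and>
       (\<forall>x\<in>{0..1}. \<forall>y\<in>{0..1::real}.
          of_int \<eta> < of_int a * x + of_int b * y \<and> of_int a * x + of_int b * y < of_int \<eta> + 1 \<longrightarrow>
          of_int e < of_int p * x + of_int q * y \<and> of_int p * x + of_int q * y < of_int e + 1))"

lemma square_dominatedI:
  fixes a b \<eta> p q e :: int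
  assumes "p \<in> {-1, 0, 1}" "q \<in> {-1, 0, 1}" "a = 0 \<Longrightarrow> p = 0" "b = 0 \<Longrightarrow> q = 0"
    and "\<And>x y :: real. \<lbrakk>0 \<le> x; x \<le> 1; 0 \<le> y; y \<le> 1;
           of_int \<eta> < of_int a * x + of_int b * y; of_int a * x + of_int b * y < of_int \<eta> + 1\<rbrakk> \<Longrightarrow>
           of_int e < of_int p * x + of_int q * y \<and> of_int p * x + of_int q * y < of_int e + 1"
  shows "square_dominated a b \<eta>"
  unfolding square_dominated_def
  by (rule bexI[of _ p], rule bexI[of _ q], rule exI[of _ e]) (use assms in auto)

lemma square_dominated_ordered:
  assumes "0 \<le> b" "b \<le> a"
  shows "square_dominated a b \<eta>"
proof -
  have products: "of_int b * x \<le> of_int a * x" "0 \<le> of_int b * x" "of_int b * x \<le> of_int b"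
    "of_int a * x \<le> of_int a" if "0 \<le> x" "x \<le> 1" for x :: real
    using that assms by (simp_all add: mult_right_mono mult_left_le)
  consider "\<eta> < 0" | "0 \<le> \<eta>" "\<eta> + 1 \<le> b" | "b \<le> \<eta>" "\<eta> + 1 \<le> a"
    | "a \<le> \<eta>" "\<eta> + 1 \<le> a + b" | "a + b \<le> \<eta>"
    by linarith
  then show ?thesis
  proof cases
    case 1
    then have "of_int \<eta> + 1 \<le> (0::real)" by linarith
    have False if "0 \<le> x" "x \<le> 1" "0 \<le> y" "y \<le> 1"
      "of_int \<eta> < of_int a * x + of_int b * y" "of_int a * x + of_int b * y < of_int \<eta> + 1" for x y :: real
      using that products[of x] products[of y] \<open>of_int \<eta> + 1 \<le> (0::real)\<close> by linarith
    then show ?thesis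
      by (intro square_dominatedI[where p = 0 and q = 0 and e = 0]) blast+
  next
    case 2
    show ?thesis
    proof (rule square_dominatedI[where p = 1 and q = 1 and e = 0])
      fix x y :: real
      assume xy: "0 \<le> x" "x \<le> 1" "0 \<le> y" "y \<le> 1"
        and strip: "of_int \<eta> < of_int a * x + of_int b * y" "of_int a * x + of_int b * y < of_int \<eta> + 1"
      have "of_int \<eta> + 1 \<le> (of_int b :: real)" using 2 by linarith
      moreover have "0 < of_int a * x + of_int b * y" using strip 2 by linarith
      then have "x \<noteq> 0 \<or> y \<noteq> 0" by auto
      ultimately have "of_int b * (x + y) < of_int b * 1"
        using strip products(1)[of x] xy by (simp add: distrib_left)
      then have "x + y < 1" by (rule mult_left_less_imp_less) (use assms in simp)
      with xy \<open>x \<noteq> 0 \<or> y \<noteq> 0\<close>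
      show "of_int 0 < of_int 1 * x + of_int 1 * y \<and> of_int 1 * x + of_int 1 * y < (of_int 0 + 1 :: real)"
        by auto
    qed (use 2 assms in auto)
  next
    case 3
    show ?thesis
    proof (rule square_dominatedI[where p = 1 and q = 0 and e = 0])
      fix x y :: real
      assume xy: "0 \<le> x" "x \<le> 1" "0 \<le> y" "y \<le> 1"
        and strip: "of_int \<eta> < of_int a * x + of_int b * y" "of_int a * x + of_int b * y < of_int \<eta> + 1"
      have "of_int \<eta> + 1 \<le> (of_int a :: real)" "(of_int b :: real) \<le> of_int \<eta>" using 3 by linarith+
      then have "x \<noteq> 0" "x \<noteq> 1"
        using strip products(2,3)[of y] xy by auto
      with xy show "of_int 0 < of_int 1 * x + of_int 0 * y \<and> of_int 1 * x + of_int 0 * y < (of_int 0 + 1 :: real)"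
        by auto
    qed (use 3 assms in auto)
  next
    case 4
    show ?thesis
    proof (rule square_dominatedI[where p = 1 and q = 1 and e = 1])
      fix x y :: real
      assume xy: "0 \<le> x" "x \<le> 1" "0 \<le> y" "y \<le> 1"
        and strip: "of_int \<eta> < of_int a * x + of_int b * y" "of_int a * x + of_int b * y < of_int \<eta> + 1"
      have bounds: "(of_int a :: real) \<le> of_int \<eta>" "of_int \<eta> + 1 \<le> (of_int a + of_int b :: real)"
        using 4 by linarith+
      then have "of_int a * 1 < of_int a * (x + y)"
        using strip products(1)[of y] xy by (simp add: distrib_left)
      then have "1 < x + y" by (rule mult_left_less_imp_less) (use assms in simp)
      moreover have "x \<noteq> 1 \<or> y \<noteq> 1" using strip bounds by auto
      ultimately show "of_int 1 < of_int 1 * x + of_int 1 * y \<and> of_int 1 * x + of_int 1 * y < (of_int 1 + 1 :: real)"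
        using xy by auto
    qed (use 4 assms in auto)
  next
    case 5
    then have "(of_int a + of_int b :: real) \<le> of_int \<eta>" by linarith
    have False if "0 \<le> x" "x \<le> 1" "0 \<le> y" "y \<le> 1"
      "of_int \<eta> < of_int a * x + of_int b * y" "of_int a * x + of_int b * y < of_int \<eta> + 1" for x y :: real
      using that products[of x] products[of y] \<open>(of_int a + of_int b :: real) \<le> of_int \<eta>\<close> by linarith
    then show ?thesis
      by (intro square_dominatedI[where p = 0 and q = 0 and e = 0]) blast+
  qed
qed

lemma square_dominated_swap:
  assumes "square_dominated a b \<eta>"
  shows "square_dominated b a \<eta>"
proof -
  obtain p q e where "p \<in> {-1, 0, 1}" "q \<in> {-1, 0, 1}" "a = 0 \<longrightarrow> p = 0" "b = 0 \<longrightarrow> q = 0"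
    and "\<forall>x\<in>{0..1}. \<forall>y\<in>{0..1::real}.
          of_int \<eta> < of_int a * x + of_int b * y \<and> of_int a * x + of_int b * y < of_int \<eta> + 1 \<longrightarrow>
          of_int e < of_int p * x + of_int q * y \<and> of_int p * x + of_int q * y < of_int e + 1"
    using assms unfolding square_dominated_def by blast
  then show ?thesis
    by (intro square_dominatedI[where p = q and q = p and e = e]) (auto simp: add.commute)
qed

text \<open>The substitution \<open>x \<mapsto> 1 - x\<close>, applied to both strips.\<close>
lemma square_dominated_reflect:
  assumes "square_dominated a b (\<eta> + a)"
  shows "square_dominated (- a) b \<eta>"
proof -
  obtain p q e where coeffs: "p \<in> {-1, 0, 1}" "q \<in> {-1, 0, 1}" "a = 0 \<longrightarrow> p = 0" "b = 0 \<longrightarrow> q = 0"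
    and dom: "\<forall>x\<in>{0..1}. \<forall>y\<in>{0..1::real}.
          of_int (\<eta> + a) < of_int a * x + of_int b * y \<and> of_int a * x + of_int b * y < of_int (\<eta> + a) + 1 \<longrightarrow>
          of_int e < of_int p * x + of_int q * y \<and> of_int p * x + of_int q * y < of_int e + 1"
    using assms unfolding square_dominated_def by blast
  show ?thesis
  proof (rule square_dominatedI[where p = "- p" and q = q and e = "e - p"])
    fix x y :: real
    assume "0 \<le> x" "x \<le> 1" "0 \<le> y" "y \<le> 1"
      "of_int \<eta> < of_int (- a) * x + of_int b * y" "of_int (- a) * x + of_int b * y < of_int \<eta> + 1"
    with dom[rule_format, of "1 - x" y]
    show "of_int (e - p) < of_int (- p) * x + of_int q * y \<and>
          of_int (- p) * x + of_int q * y < of_int (e - p) + 1"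
      by (simp add: algebra_simps)
  qed (use coeffs in auto)
qed

lemma square_dominated: "square_dominated a b \<eta>"
proof -
  have nonneg: "square_dominated a b \<eta>" if "0 \<le> a" "0 \<le> b" for a b \<eta>
    using that square_dominated_ordered square_dominated_swap by (cases "b \<le> a") auto
  have half: "square_dominated a b \<eta>" if "0 \<le> b" for a b \<eta>
    using nonneg[of a b \<eta>] square_dominated_reflect[OF nonneg, of "- a" b \<eta>] that
    by (cases "0 \<le> a") auto
  show ?thesis
    using half[of b a \<eta>]
      square_dominated_swap[OF square_dominated_reflect[OF square_dominated_swap[OF half]], of "- b" a \<eta>]
    by (cases "0 \<le> b") auto
qed

lemma card_le_2_subset_pair:
  assumes "finite A" "card A \<le> 2"
  shows "\<exists>i j. A \<subseteq> {i, j}"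
proof -
  consider "card A = 0" | "card A = 1" | "card A = 2" using assms(2) by linarith
  then show ?thesis
    using assms(1) by cases (auto simp: card_1_singleton_iff card_2_iff)
qed

lemma of_int_vec_inner_pair:
  fixes \<rho> :: "int ^ 'n" and x :: "real ^ 'n"
  assumes "{k. \<rho> $ k \<noteq> 0} \<subseteq> {i, j}"
  shows "(\<chi> k. of_int (\<rho> $ k)) \<bullet> x =
           of_int (\<rho> $ i) * x $ i + of_int (if j = i then 0 else \<rho> $ j) * x $ j"
proof -
  have "(\<chi> k. of_int (\<rho> $ k)) \<bullet> x = (\<Sum>k\<in>UNIV. of_int (\<rho> $ k) * x $ k)"
    by (simp add: inner_vec_def)
  also have "\<dots> = (\<Sum>k\<in>{i, j}. of_int (\<rho> $ k) * x $ k)"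
    by (rule sum.mono_neutral_right) (use assms in auto)
  finally show ?thesis by (cases "j = i") auto
qed

text \<open>Only the coefficients have to be checked: the offset is bounded because the form has
  absolute value at most \<open>k\<close> on the cube.\<close>
lemma split_set_in_split_family:
  fixes \<rho> :: "int ^ 'n"
  assumes sparse: "sparse_split k \<rho> e" and coeffs: "\<forall>i. \<rho> $ i \<in> {-1, 0, 1}"
    and x: "x \<in> split_set \<rho> e" "x \<in> cbox 0 1"
  shows "split_set \<rho> e \<in> split_family k"
proof -
  have x01: "0 \<le> x $ i" "x $ i \<le> 1" for i
    using x(2) by (auto simp: mem_box_cart)
  have "\<bar>(\<chi> i. of_int (\<rho> $ i)) \<bullet> x\<bar> = \<bar>\<Sum>i\<in>UNIV. of_int (\<rho> $ i) * x $ i\<bar>"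
    by (simp add: inner_vec_def)
  also have "\<dots> = \<bar>\<Sum>i | \<rho> $ i \<noteq> 0. of_int (\<rho> $ i) * x $ i\<bar>"
    by (subst sum.mono_neutral_right[of UNIV "{i. \<rho> $ i \<noteq> 0}"]) auto
  also have "\<dots> \<le> (\<Sum>i | \<rho> $ i \<noteq> 0. \<bar>of_int (\<rho> $ i) * x $ i\<bar>)"
    by (rule sum_abs)
  also have "\<dots> \<le> of_nat (card {i. \<rho> $ i \<noteq> 0}) * 1"
  proof (rule sum_bounded_above)
    fix i
    show "\<bar>of_int (\<rho> $ i) * x $ i\<bar> \<le> 1"
      using coeffs[rule_format, of i] x01[of i] by auto
  qed
  also have "\<dots> \<le> of_nat k"
    using sparse by (simp add: sparse_split_def norm0_def)
  finally have "\<bar>(\<chi> i. of_int (\<rho> $ i)) \<bullet> x\<bar> \<le> of_nat k" .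
  then have "e \<in> {- int k..int k}"
    using x(1) unfolding split_set_def by simp linarith
  then show ?thesis
    using sparse coeffs unfolding split_family_def by blast
qed

lemma empty_in_split_family: "({} :: (real ^ 'n) set) \<in> split_family k"
proof -
  have "split_set (0 :: int ^ 'n) 0 = {}"
    by (auto simp: split_set_def inner_vec_def)
  moreover have "split_set (0 :: int ^ 'n) 0 \<in> split_family k"
    unfolding split_family_def
    by (rule CollectI, intro exI[of _ 0]) (auto simp: sparse_split_def norm0_def)
  ultimately show ?thesis by simp
qed

theorem proposition1:
  fixes \<pi> :: "int ^ 'n" and \<eta> :: int
  assumes "sparse_split 2 \<pi> \<eta>"
  shows "\<exists>T \<in> split_family 2. dominates T (split_set \<pi> \<eta>)"
proof (cases "split_set \<pi> \<eta> \<inter> cbox 0 1 = {}")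
  case True
  then show ?thesis
    using empty_in_split_family by (auto simp: dominates_def)
next
  case False
  then obtain z where z: "z \<in> split_set \<pi> \<eta>" "z \<in> cbox 0 1" by auto
  obtain i j where supp: "{k. \<pi> $ k \<noteq> 0} \<subseteq> {i, j}"
    using assms card_le_2_subset_pair[of "{k. \<pi> $ k \<noteq> 0}"]
    by (auto simp: sparse_split_def norm0_def)
  \<comment> \<open>If the support lies in a single coordinate, \<open>i\<close> and \<open>j\<close> may coincide; the second
    coefficient is then taken to be zero.\<close>
  define b where "b = (if j = i then 0 else \<pi> $ j)"
  obtain p q e where coeffs: "p \<in> {-1, 0, 1}" "q \<in> {-1, 0, 1}" "b = 0 \<longrightarrow> q = 0"
    and dom: "\<And>x y :: real. \<lbrakk>0 \<le> x; x \<le> 1; 0 \<le> y; y \<le> 1;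
          of_int \<eta> < of_int (\<pi> $ i) * x + of_int b * y; of_int (\<pi> $ i) * x + of_int b * y < of_int \<eta> + 1\<rbrakk> \<Longrightarrow>
          of_int e < of_int p * x + of_int q * y \<and> of_int p * x + of_int q * y < of_int e + 1"
    using square_dominated[of "\<pi> $ i" b \<eta>] unfolding square_dominated_def by (metis atLeastAtMost_iff)
  define \<rho> :: "int ^ 'n" where "\<rho> = (\<chi> k. if k = i then p else if k = j then q else 0)"
  have supp_\<rho>: "{k. \<rho> $ k \<noteq> 0} \<subseteq> {i, j}"
    by (auto simp: \<rho>_def)
  have inner_\<rho>: "(\<chi> k. of_int (\<rho> $ k)) \<bullet> x = of_int p * x $ i + of_int q * x $ j" for x :: "real ^ 'n"
    using of_int_vec_inner_pair[OF supp_\<rho>, of x] coeffs(3) by (auto simp: \<rho>_def b_def)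
  have subset: "x \<in> split_set \<rho> e" if "x \<in> split_set \<pi> \<eta>" "x \<in> cbox 0 1" for x
    using dom[of "x $ i" "x $ j"] that of_int_vec_inner_pair[OF supp, of x, folded b_def]
    unfolding split_set_def inner_\<rho> by (simp add: mem_box_cart)
  have "card {k. \<rho> $ k \<noteq> 0} \<le> card {i, j}"
    using supp_\<rho> by (intro card_mono) auto
  also have "\<dots> \<le> 2" by (simp add: card_insert_if)
  finally have "sparse_split 2 \<rho> e"
    by (simp add: sparse_split_def norm0_def)
  then have "split_set \<rho> e \<in> split_family 2"
    using split_set_in_split_family[OF _ _ subset[OF z] z(2)] coeffs by (auto simp: \<rho>_def)
  then show ?thesis
    using subset by (auto simp: dominates_def)
qed

end
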